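(* Let $Z=\{P_1,\dots,P_r\}\subset\mathbb{P}^n$ be a finite set of distinct points over $\mathbb{C}$ and let $d\ge 1$. Let $T=T(Z+dQ,d)$ and $N=(\Lambda(Z+dQ,d))^t$ be the $\binom{n+d}{n}\times\left(r+\binom{n+d-1}{n}\right)$ matrices defined in the context. Let $A$ be a minor of $T$ coming from a given choice of $s$ rows and $s$ columns of $T$. Assume that the chosen rows correspond to the monomials $M_{i_1},\dots,M_{i_s}$ of degree $d$, and that $j$ of the chosen columns are among the first $r$ columns of $T$ (those corresponding to the points of $Z$). Let $B$ be the corresponding minor of $N$ (same rows and same columns). Then $$B=\frac{e_{M_{i_1}}\cdots e_{M_{i_s}}}{(d!)^j}\,A,$$ and thus $I_s(T(Z+dQ,d))=I_s(\Lambda(Z+dQ,d))$, where $I_s(\cdot)$ denotes the ideal of $\mathbb{C}[x_0,\dots,x_n]$ generated by all $s\times s$ minors of the matrix.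
   Context: Let $R=\mathbb{C}[x_0,\dots,x_n]$. For a monomial $M=x_0^{i_0}\cdots x_n^{i_n}$ put $e_M=i_0!\cdots i_n!$ and $c_M=\frac{(i_0+\cdots+i_n)!}{i_0!\cdots i_n!}=\deg(M)!/e_M$, and let $\partial_M=\frac{\partial^{i_0}}{\partial x_0^{i_0}}\cdots\frac{\partial^{i_n}}{\partial x_n^{i_n}}$. Enumerate the monomials of degree $d-1$ as $m_1,\dots,m_{\binom{n+d-1}{n}}$ and the monomials of degree $d$ as $M_1,\dots,M_{\binom{n+d}{n}}$. Fix a representative coordinate vector for each point $P_i$, so that $M(P_i)$ makes sense, and let $Q=[x_0:\dots:x_n]$ be the point whose coordinates are the variables. The interpolation matrix $\Lambda(Z+dQ,d)$ has columns indexed by the $M_j$; its first $r$ rows are indexed by the points $P_i$, with entries $M_j(P_i)$; its remaining rows are indexed by the $m_i$, with entries $\partial_{m_i}M_j$ (which is $0$ if $m_i\nmid M_j$ and equals $e_{M_j}x_k$ if $M_j=m_ix_k$). $N$ denotes its transpose. The Macaulay duality matrix $T=T(Z+dQ,d)=[T_1\,|\,T_2]$ has rows indexed by the $M_i$. $T_1$ has $r$ columns indexed by the points, with $(T_1)_{M_i,P_j}=c_{M_i}M_i(P_j)$. $T_2$ has columns indexed by the $m_j$, with $(T_2)_{M_i,m_j}=x_k$ if $M_i=m_jx_k$, and $0$ if $m_j\nmid M_i$. *)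

theory Defs
  imports
    "HOL-Library.Cardinality"
    "HOL-Library.Poly_Mapping"
    "HOL-Algebra.Algebraic_Closure_Type"
    "Jordan_Normal_Form.Determinant"
    "Jordan_Normal_Form.DL_Submatrix"
begin

section \<open>Polynomials and partial derivatives\<close>

text \<open>
  The polynomial ring \<open>\<complex>[x\<^sub>0,\<dots>,x\<^sub>n]\<close> is the monoid algebra over the exponent vectors; the
  variables are indexed by a finite type \<open>'n\<close> with \<open>CARD('n) = n + 1\<close>.  Multiplication of
  monomials is addition of exponent vectors.
\<close>

abbreviation "lookup \<equiv> Poly_Mapping.lookup"
abbreviation "single \<equiv> Poly_Mapping.single"
abbreviation "keys \<equiv> Poly_Mapping.keys"

type_synonym 'n monomial = "'n \<Rightarrow>\<^sub>0 nat"
type_synonym 'n poly_ring = "'n monomial \<Rightarrow>\<^sub>0 complex"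

definition const_poly :: "complex \<Rightarrow> 'n poly_ring" where
  "const_poly c = single 0 c"

definition monomial_poly :: "'n monomial \<Rightarrow> 'n poly_ring" where
  "monomial_poly M = single M 1"

definition var_monomial :: "'n \<Rightarrow> 'n monomial" where
  "var_monomial k = single k 1"

definition var_poly :: "'n \<Rightarrow> 'n poly_ring" where
  "var_poly k = monomial_poly (var_monomial k)"

definition monomial_degree :: "'n::finite monomial \<Rightarrow> nat" where
  "monomial_degree M = (\<Sum>k\<in>UNIV. lookup M k)"

definition monomials_of_degree :: "nat \<Rightarrow> 'n::finite monomial set" where
  "monomials_of_degree d = {M. monomial_degree M = d}"

definition monomial_value :: "'n::finite monomial \<Rightarrow> ('n \<Rightarrow> complex) \<Rightarrow> complex" where
  "monomial_value M v = (\<Prod>k\<in>UNIV. v k ^ lookup M k)"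

definition monomial_e :: "'n::finite monomial \<Rightarrow> nat" where
  "monomial_e M = (\<Prod>k\<in>UNIV. fact (lookup M k))"

definition monomial_c :: "'n::finite monomial \<Rightarrow> complex" where
  "monomial_c M = fact (monomial_degree M) / of_nat (monomial_e M)"

text \<open>
  Subtraction of exponents is truncated, but the terms in which it truncates have coefficient 0.
\<close>

definition partial_deriv :: "'n \<Rightarrow> 'n poly_ring \<Rightarrow> 'n poly_ring" where
  "partial_deriv k p =
     (\<Sum>t\<in>keys p. single (t - var_monomial k) (of_nat (lookup t k) * lookup p t))"

text \<open>
  The operator \<open>\<partial>\<^sub>M\<close>: apply \<open>\<partial>/\<partial>x\<^sub>k\<close> as often as \<open>x\<^sub>k\<close> occurs in \<open>M\<close>, for every \<open>k\<close>.  The fold over the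
  unordered set of variables is well defined by \<open>comp_fun_commute_partial_deriv\<close> below.
\<close>

definition monomial_deriv :: "'n::finite monomial \<Rightarrow> 'n poly_ring \<Rightarrow> 'n poly_ring" where
  "monomial_deriv M p = Finite_Set.fold (\<lambda>k. partial_deriv k ^^ lookup M k) p UNIV"

lemma lookup_partial_deriv:
  "lookup (partial_deriv k p) t = of_nat (lookup t k + 1) * lookup p (t + var_monomial k)"
proof -
  have "lookup (partial_deriv k p) t
      = (\<Sum>u\<in>keys p. if u = t + var_monomial k then of_nat (lookup u k) * lookup p u else 0)"
    unfolding partial_deriv_def lookup_sum
  proof (rule sum.cong)
    fix u
    have shift: "u - var_monomial k = t \<longleftrightarrow> u = t + var_monomial k" if u: "lookup u k \<noteq> 0"
    proof
      assume t: "u - var_monomial k = t"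
      show "u = t + var_monomial k"
      proof (rule poly_mapping_eqI)
        fix l
        have "lookup t l = lookup u l - lookup (var_monomial k) l"
          unfolding t[symmetric] by (rule lookup_minus)
        then show "lookup u l = lookup (t + var_monomial k) l"
          using u by (cases "l = k") (simp_all add: lookup_add var_monomial_def lookup_single)
      qed
    qed simp
    show "lookup (single (u - var_monomial k) (of_nat (lookup u k) * lookup p u)) t =
        (if u = t + var_monomial k then of_nat (lookup u k) * lookup p u else 0)"
    proof (cases "lookup u k = 0")
      case False
      then show ?thesis
        using shift by (simp add: lookup_single when_def)
    qed auto
  qed simp
  also have "\<dots> = of_nat (lookup t k + 1) * lookup p (t + var_monomial k)"
    by (simp add: in_keys_iff var_monomial_def lookup_add lookup_single)
  finally show ?thesis .
qed

lemma partial_deriv_commute: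
  "partial_deriv k (partial_deriv l p) = partial_deriv l (partial_deriv k p)"
proof (rule poly_mapping_eqI)
  have exp_swap: "t + var_monomial k + var_monomial l = t + var_monomial l + var_monomial k"
    for t :: "'a monomial" and k l by (simp add: add.assoc add.commute[of "var_monomial k"])
  fix t
  show "lookup (partial_deriv k (partial_deriv l p)) t = lookup (partial_deriv l (partial_deriv k p)) t"
    using exp_swap[of t k l]
    by (cases "k = l")
       (simp_all add: lookup_partial_deriv lookup_add var_monomial_def lookup_single)
qed

lemma comp_fun_commute_partial_deriv:
  fixes M :: "'n monomial"
  shows "comp_fun_commute (\<lambda>k. partial_deriv k ^^ lookup M k)"
proof
  fix k l :: 'n
  have "((partial_deriv k ^^ a) \<circ> (partial_deriv l ^^ b)) = ((partial_deriv l ^^ b) \<circ> (partial_deriv k ^^ a))"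
    for a b
  proof -
    have 1: "partial_deriv k ((partial_deriv l ^^ b) p) = (partial_deriv l ^^ b) (partial_deriv k p)" for p
      by (induction b) (simp_all add: partial_deriv_commute[of k l])
    show ?thesis
      by (induction a) (auto simp: fun_eq_iff 1)
  qed
  then show "(partial_deriv l ^^ lookup M l) \<circ> (partial_deriv k ^^ lookup M k) =
      (partial_deriv k ^^ lookup M k) \<circ> (partial_deriv l ^^ lookup M l)"
    by simp
qed


section \<open>Projective space\<close>

text \<open>
  A point of \<open>\<P>\<^sup>n\<close> is the class of all its nonzero coordinate vectors, so \<open>v \<in> P\<close> says that
  \<open>v\<close> is a representative of the point \<open>P\<close>.
\<close>

definition proportional :: "(('n \<Rightarrow> complex) \<times> ('n \<Rightarrow> complex)) set" where
  "proportional = {(v, w). v \<noteq> (\<lambda>_. 0) \<and> w \<noteq> (\<lambda>_. 0) \<and> (\<exists>c. c \<noteq> 0 \<and> w = (\<lambda>k. c * v k))}"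

definition projective_space :: "('n \<Rightarrow> complex) set set" where
  "projective_space = (UNIV - {\<lambda>_. 0}) // proportional"


section \<open>The two matrices\<close>

text \<open>
  In both matrices the \<open>r\<close> points have coordinate vectors \<open>v 0, \<dots>, v (r - 1)\<close>, the monomials of
  degree \<open>d - 1\<close> are \<open>m 0, m 1, \<dots>\<close>, and those of degree \<open>d\<close> are \<open>M 0, M 1, \<dots>\<close>.
\<close>

definition interpolation_matrix ::
  "nat \<Rightarrow> nat \<Rightarrow> nat \<Rightarrow> (nat \<Rightarrow> 'n::finite \<Rightarrow> complex) \<Rightarrow> (nat \<Rightarrow> 'n monomial) \<Rightarrow> (nat \<Rightarrow> 'n monomial)
     \<Rightarrow> 'n poly_ring mat" where
  "interpolation_matrix n d r v m M =
     mat (r + ((n + d - 1) choose n)) ((n + d) choose n)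
       (\<lambda>(i, j). if i < r then const_poly (monomial_value (M j) (v i))
                 else monomial_deriv (m (i - r)) (monomial_poly (M j)))"

definition macaulay_duality_matrix ::
  "nat \<Rightarrow> nat \<Rightarrow> nat \<Rightarrow> (nat \<Rightarrow> 'n::finite \<Rightarrow> complex) \<Rightarrow> (nat \<Rightarrow> 'n monomial) \<Rightarrow> (nat \<Rightarrow> 'n monomial)
     \<Rightarrow> 'n poly_ring mat" where
  "macaulay_duality_matrix n d r v m M =
     mat ((n + d) choose n) (r + ((n + d - 1) choose n))
       (\<lambda>(i, j). if j < r then const_poly (monomial_c (M i) * monomial_value (M i) (v j))
                 else if \<exists>k. M i = m (j - r) + var_monomial k
                 then var_poly (THE k. M i = m (j - r) + var_monomial k)
                 else 0)"


section \<open>Minors and their ideals\<close>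

definition minor :: "'a::comm_ring_1 mat \<Rightarrow> nat set \<Rightarrow> nat set \<Rightarrow> 'a" where
  "minor A I J = det (submatrix A I J)"

definition minor_choice :: "'a mat \<Rightarrow> nat \<Rightarrow> nat set \<Rightarrow> nat set \<Rightarrow> bool" where
  "minor_choice A s I J \<longleftrightarrow>
     I \<subseteq> {..<dim_row A} \<and> J \<subseteq> {..<dim_col A} \<and> card I = s \<and> card J = s"

definition minors_ideal :: "nat \<Rightarrow> 'a::comm_ring_1 mat \<Rightarrow> 'a set" where
  "minors_ideal s A =
     genideal ring_of_type_algebra {minor A I J | I J. minor_choice A s I J}"

end

theory Submission
  imports Defs
begin

text \<open>
  Passing from \<open>T\<close> to \<open>N\<close> multiplies row \<open>M\<close> by \<open>e\<^sub>M\<close> and each of the \<open>r\<close> point columns by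
  \<open>1/d!\<close>.  In a point column this is the identity \<open>e\<^sub>M c\<^sub>M = d!\<close>.  In the column of a monomial \<open>m\<close> of
  degree \<open>d - 1\<close> it is the computation of \<open>\<partial>\<^sub>m M\<close>: by the Taylor coefficient identity
  \<open>e\<^sub>t [x\<^sup>t] \<partial>\<^sub>m p = e\<^bsub>t+m\<^esub> [x\<^bsup>t+m\<^esup>] p\<close> (\<open>lookup_monomial_deriv\<close>), only exponents \<open>t\<close> with \<open>t + m = M\<close>
  contribute; such a \<open>t\<close> has degree 1, so it is a variable \<open>x\<^sub>k\<close>, and as \<open>e\<^sub>t = 1\<close> the result is
  \<open>e\<^sub>M x\<^sub>k\<close>, which is \<open>e\<^sub>M\<close> times the entry of \<open>T\<close>.

  A determinant is multiplicative in scalings of rows and columns, which gives the formula for the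
  minors.  The scaling factor of each minor is a nonzero constant, hence a unit of the polynomial
  ring, so the two families of minors generate the same ideals.
\<close>

section \<open>Derivatives of monomials\<close>

lemma lookup_partial_deriv_funpow:
  "fact (lookup t k) * lookup ((partial_deriv k ^^ a) p) t
     = fact (lookup t k + a) * lookup p (t + single k a)"
proof (induction a arbitrary: t)
  case 0
  then show ?case by simp
next
  case (Suc a)
  have exponent: "t + var_monomial k + single k a = t + single k (Suc a)"
    by (simp add: var_monomial_def add.assoc single_add[symmetric])
  have "fact (lookup t k) * lookup ((partial_deriv k ^^ Suc a) p) t
      = fact (lookup (t + var_monomial k) k)
          * lookup ((partial_deriv k ^^ a) p) (t + var_monomial k)"
    by (simp add: lookup_partial_deriv lookup_add var_monomial_def algebra_simps)
  also have "\<dots> = fact (lookup (t + var_monomial k) k + a)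
          * lookup p (t + var_monomial k + single k a)"
    by (rule Suc.IH)
  also have "\<dots> = fact (lookup t k + Suc a) * lookup p (t + single k (Suc a))"
    unfolding exponent by (simp add: lookup_add var_monomial_def)
  finally show ?case .
qed

text \<open>
  Differentiation in \<open>x\<^sub>l\<close> shifts only the exponent of \<open>x\<^sub>l\<close>, so the variables contribute independent
  factors.  Multiplying by \<open>\<Prod>k\<in>S. fact (lookup t k)\<close> turns the falling factorials
  \<open>(t\<^sub>k + M\<^sub>k)! / t\<^sub>k!\<close> into factorials.
\<close>

lemma lookup_fold_partial_deriv:
  assumes "finite S"
  shows "(\<Prod>k\<in>S. fact (lookup t k))
           * lookup (Finite_Set.fold (\<lambda>k. partial_deriv k ^^ lookup M k) p S) t
       = (\<Prod>k\<in>S. fact (lookup t k + lookup M k)) * lookup p (t + (\<Sum>k\<in>S. single k (lookup M k)))"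
  using assms
proof (induction S arbitrary: t rule: finite_induct)
  case empty
  then show ?case by simp
next
  case (insert l S)
  interpret comp_fun_commute "\<lambda>k. partial_deriv k ^^ lookup M k"
    by (rule comp_fun_commute_partial_deriv)
  let ?F = "Finite_Set.fold (\<lambda>k. partial_deriv k ^^ lookup M k) p"
  let ?t = "t + single l (lookup M l)"
  have off_l: "lookup ?t k = lookup t k" if "k \<in> S" for k
    using that insert.hyps(2) by (auto simp: lookup_add lookup_single when_def)
  have "(\<Prod>k\<in>insert l S. fact (lookup t k)) * lookup (?F (insert l S)) t
      = (\<Prod>k\<in>S. fact (lookup t k))
          * (fact (lookup t l) * lookup ((partial_deriv l ^^ lookup M l) (?F S)) t)"
    using insert.hyps by (simp add: mult_ac)
  also have "\<dots> = fact (lookup t l + lookup M l) * ((\<Prod>k\<in>S. fact (lookup ?t k)) * lookup (?F S) ?t)"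
    using off_l by (simp add: lookup_partial_deriv_funpow)
  also have "\<dots> = fact (lookup t l + lookup M l) * ((\<Prod>k\<in>S. fact (lookup ?t k + lookup M k))
          * lookup p (?t + (\<Sum>k\<in>S. single k (lookup M k))))"
    by (simp only: insert.IH)
  also have "\<dots> = (\<Prod>k\<in>insert l S. fact (lookup t k + lookup M k))
          * lookup p (t + (\<Sum>k\<in>insert l S. single k (lookup M k)))"
    using insert.hyps off_l by (simp add: add.assoc mult.assoc)
  finally show ?case .
qed

lemma sum_single_lookup:
  fixes M :: "'n::finite monomial"
  shows "(\<Sum>k\<in>UNIV. single k (lookup M k)) = M"
  by (rule poly_mapping_eqI) (simp add: lookup_sum lookup_single when_def)

lemma lookup_monomial_deriv:
  "of_nat (monomial_e t) * lookup (monomial_deriv m p) t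
     = of_nat (monomial_e (t + m)) * lookup p (t + m)"
  using lookup_fold_partial_deriv[of UNIV t m p]
  by (simp add: monomial_deriv_def monomial_e_def sum_single_lookup lookup_add)

lemma monomial_e_pos: "monomial_e M > 0"
  by (simp add: monomial_e_def prod_pos)

lemma monomial_degree_add: "monomial_degree (M + m) = monomial_degree M + monomial_degree m"
  by (simp add: monomial_degree_def lookup_add sum.distrib)

lemma monomial_degree_eq_1:
  assumes "monomial_degree t = 1"
  shows "\<exists>k. t = var_monomial k"
proof -
  obtain k where k: "lookup t k = 1" and others: "\<And>l. l \<noteq> k \<Longrightarrow> lookup t l = 0"
    using assms unfolding monomial_degree_def sum_eq_1_iff[OF finite] by auto
  have "t = var_monomial k"
    using k others by (intro poly_mapping_eqI) (auto simp: var_monomial_def lookup_single when_def)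
  then show ?thesis ..
qed

lemma inj_var_monomial: "var_monomial k = var_monomial l \<Longrightarrow> k = l"
  by (metis var_monomial_def lookup_single_eq lookup_single_not_eq one_neq_zero)

lemma monomial_e_var_monomial: "monomial_e (var_monomial k) = 1"
  unfolding monomial_e_def
  by (rule prod.neutral) (simp add: var_monomial_def lookup_single when_def)

lemma const_poly_mult: "const_poly (a * b) = const_poly a * const_poly b"
  by (simp add: const_poly_def mult_single)

lemma const_poly_1: "const_poly 1 = 1"
  by (simp add: const_poly_def)

lemma const_poly_prod: "const_poly (\<Prod>i\<in>I. f i) = (\<Prod>i\<in>I. const_poly (f i))"
  by (induction I rule: infinite_finite_induct) (simp_all add: const_poly_1 const_poly_mult)

lemma monomial_deriv_times_variable:
  "monomial_deriv m (monomial_poly (m + var_monomial k))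
     = const_poly (of_nat (monomial_e (m + var_monomial k))) * var_poly k"
proof (rule poly_mapping_eqI)
  fix t
  let ?M = "m + var_monomial k"
  have exponent: "?M = t + m \<longleftrightarrow> var_monomial k = t"
    by (metis add.commute add_left_cancel)
  have "const_poly c * var_poly k = single (var_monomial k) c" for c
    by (simp add: const_poly_def var_poly_def monomial_poly_def mult_single)
  then have "of_nat (monomial_e t) * lookup (monomial_deriv m (monomial_poly ?M)) t
      = of_nat (monomial_e t) * lookup (const_poly (of_nat (monomial_e ?M)) * var_poly k) t"
    by (auto simp: lookup_monomial_deriv monomial_poly_def
        lookup_single when_def exponent monomial_e_var_monomial add.commute)
  then show "lookup (monomial_deriv m (monomial_poly ?M)) t
      = lookup (const_poly (of_nat (monomial_e ?M)) * var_poly k) t"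
    using monomial_e_pos[of t] by simp
qed

lemma monomial_deriv_not_dvd:
  assumes "\<And>t. M \<noteq> t + m"
  shows "monomial_deriv m (monomial_poly M) = 0"
proof (rule poly_mapping_eqI)
  fix t
  have "of_nat (monomial_e t) * lookup (monomial_deriv m (monomial_poly M)) t = 0"
    using assms by (simp add: lookup_monomial_deriv monomial_poly_def lookup_single when_def)
  then show "lookup (monomial_deriv m (monomial_poly M)) t = lookup 0 t"
    using monomial_e_pos[of t] by simp
qed

text \<open>
  When the degrees of \<open>M\<close> and \<open>m\<close> differ by one, a quotient \<open>M/m\<close> can only be a variable, so the two
  cases above are exhaustive.
\<close>

lemma monomial_deriv_degree_Suc:
  assumes "monomial_degree M = Suc (monomial_degree m)"
  shows "monomial_deriv m (monomial_poly M) = const_poly (of_nat (monomial_e M)) *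
    (if \<exists>k. M = m + var_monomial k then var_poly (THE k. M = m + var_monomial k) else 0)"
proof (cases "\<exists>k. M = m + var_monomial k")
  case True
  then obtain k where k: "M = m + var_monomial k" ..
  have "(THE k. M = m + var_monomial k) = k"
    by (rule the_equality) (auto simp: k dest: inj_var_monomial)
  then show ?thesis
    using True by (simp add: k monomial_deriv_times_variable)
next
  case False
  have "M \<noteq> t + m" for t
  proof
    assume t: "M = t + m"
    then have "monomial_degree t = 1"
      using assms by (simp add: monomial_degree_add)
    then show False
      using monomial_degree_eq_1[of t] False t by (auto simp: add.commute)
  qed
  then show ?thesis
    using False by (simp add: monomial_deriv_not_dvd)
qed


section \<open>Minors under scaling and transposition\<close>

text \<open>In the Leibniz formula every term uses each row and each column exactly once.\<close>

lemma det_rescale: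
  assumes A: "A \<in> carrier_mat s s" and B: "B \<in> carrier_mat s s"
    and entries: "\<And>i j. i < s \<Longrightarrow> j < s \<Longrightarrow> B $$ (i, j) = a i * b j * A $$ (i, j)"
  shows "det B = (\<Prod>i<s. a i) * (\<Prod>j<s. b j) * det A"
proof -
  have "signof p * (\<Prod>i = 0..<s. B $$ (i, p i))
      = (\<Prod>i<s. a i) * (\<Prod>j<s. b j) * (signof p * (\<Prod>i = 0..<s. A $$ (i, p i)))"
    if p: "p permutes {0..<s}" for p
  proof -
    have "(\<Prod>i = 0..<s. B $$ (i, p i)) = (\<Prod>i = 0..<s. a i * b (p i) * A $$ (i, p i))"
      using permutes_in_image[OF p] by (intro prod.cong) (auto simp: entries)
    also have "\<dots> = (\<Prod>i = 0..<s. a i) * (\<Prod>i = 0..<s. b (p i)) * (\<Prod>i = 0..<s. A $$ (i, p i))"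
      by (simp add: prod.distrib)
    also have "(\<Prod>i = 0..<s. b (p i)) = (\<Prod>j = 0..<s. b j)"
      using prod.permute[OF p, of b] by simp
    finally show ?thesis
      by (simp add: atLeast0LessThan mult_ac)
  qed
  then show ?thesis
    unfolding det_def'[OF A] det_def'[OF B] sum_distrib_left by (intro sum.cong) auto
qed

lemma bij_betw_pick:
  assumes "finite I"
  shows "bij_betw (pick I) {..<card I} I"
proof -
  have inj: "inj_on (pick I) {..<card I}"
    by (rule linorder_inj_onI) (auto dest: pick_mono_le[of _ I])
  moreover have "pick I ` {..<card I} \<subseteq> I"
    by (auto intro: pick_in_set_le)
  ultimately show ?thesis
    using assms by (simp add: bij_betw_def card_image card_subset_eq)
qed

lemma chosen_indices:
  fixes I :: "nat set"
  assumes "I \<subseteq> {..<k}"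
  shows "{i. i < k \<and> i \<in> I} = I"
  using assms by auto

lemma minor_rescale:
  assumes choice: "minor_choice A s I J"
    and dims: "dim_row B = dim_row A" "dim_col B = dim_col A"
    and entries: "\<And>i j. i \<in> I \<Longrightarrow> j \<in> J \<Longrightarrow> B $$ (i, j) = a i * b j * A $$ (i, j)"
  shows "minor B I J = (\<Prod>i\<in>I. a i) * (\<Prod>j\<in>J. b j) * minor A I J"
proof -
  have I: "I \<subseteq> {..<dim_row A}" "card I = s" and J: "J \<subseteq> {..<dim_col A}" "card J = s"
    using choice by (auto simp: minor_choice_def)
  note chosen = chosen_indices[OF I(1)] chosen_indices[OF J(1)]
  have fin: "finite I" "finite J"
    using I J finite_subset by blast+
  have "minor B I J = (\<Prod>i<s. a (pick I i)) * (\<Prod>j<s. b (pick J j)) * minor A I J"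
    unfolding minor_def
  proof (rule det_rescale)
    show "submatrix A I J \<in> carrier_mat s s" "submatrix B I J \<in> carrier_mat s s"
      by (auto simp: dim_submatrix dims chosen I J)
    fix i j assume "i < s" "j < s"
    then show "submatrix B I J $$ (i, j)
        = a (pick I i) * b (pick J j) * submatrix A I J $$ (i, j)"
      by (simp add: submatrix_index dims chosen I J entries pick_in_set_le)
  qed
  moreover have "(\<Prod>i<s. a (pick I i)) = (\<Prod>i\<in>I. a i)"
    using prod.reindex_bij_betw[OF bij_betw_pick[OF fin(1)], of a] I by simp
  moreover have "(\<Prod>j<s. b (pick J j)) = (\<Prod>j\<in>J. b j)"
    using prod.reindex_bij_betw[OF bij_betw_pick[OF fin(2)], of b] J by simp
  ultimately show ?thesis by simp
qed

lemma minor_choice_transpose: "minor_choice (transpose_mat A) s I J \<longleftrightarrow> minor_choice A s J I"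
  by (auto simp: minor_choice_def)

lemma minor_transpose:
  assumes "minor_choice A s I J"
  shows "minor (transpose_mat A) J I = minor A I J"
proof -
  have I: "I \<subseteq> {..<dim_row A}" "card I = s" and J: "J \<subseteq> {..<dim_col A}" "card J = s"
    using assms by (auto simp: minor_choice_def)
  note chosen = chosen_indices[OF I(1)] chosen_indices[OF J(1)]
  have "submatrix (transpose_mat A) J I = transpose_mat (submatrix A I J)"
  proof (rule eq_matI)
    fix i j
    assume "i < dim_row (transpose_mat (submatrix A I J))"
      and "j < dim_col (transpose_mat (submatrix A I J))"
    then have ij: "i < card J" "j < card I"
      by (simp_all add: dim_submatrix chosen)
    then have "pick J i < dim_col A" "pick I j < dim_row A"
      using pick_in_set_le[of i J] pick_in_set_le[of j I] I J by auto
    then show "submatrix (transpose_mat A) J I $$ (i, j) = transpose_mat (submatrix A I J) $$ (i, j)"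
      using ij by (simp add: submatrix_index chosen dim_submatrix)
  qed (simp_all add: dim_submatrix)
  moreover have "submatrix A I J \<in> carrier_mat s s"
    by (auto simp: dim_submatrix chosen I J)
  ultimately show ?thesis
    by (simp add: minor_def det_transpose)
qed

lemma minors_ideal_transpose: "minors_ideal s (transpose_mat A) = minors_ideal s A"
proof -
  have "{minor (transpose_mat A) I J | I J. minor_choice (transpose_mat A) s I J}
      = {minor A I J | I J. minor_choice A s I J}"
    unfolding minor_choice_transpose using minor_transpose[of A s] by (auto; metis)
  then show ?thesis
    by (simp add: minors_ideal_def)
qed

lemma minors_ideal_mono:
  fixes A B :: "'a::comm_ring_1 mat"
  assumes multiple: "\<And>I J. minor_choice A s I J \<Longrightarrow>
      minor_choice B s I J \<and> (\<exists>u. minor A I J = u * minor B I J)"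
  shows "minors_ideal s A \<subseteq> minors_ideal s B"
proof -
  let ?R = "ring_of_type_algebra :: 'a ring"
  let ?G = "{minor B I J | I J. minor_choice B s I J}"
  interpret R: cring ?R
    by (rule cring_from_type_algebra)
  have carrier: "carrier ?R = UNIV" and mult: "x \<otimes>\<^bsub>?R\<^esub> y = x * y" for x y
    by (simp_all add: ring_of_type_algebra_def)
  interpret B: ideal "Idl\<^bsub>?R\<^esub> ?G" ?R
    by (rule R.genideal_ideal) (simp add: carrier)
  have "minor A I J \<in> Idl\<^bsub>?R\<^esub> ?G" if IJ: "minor_choice A s I J" for I J
  proof -
    obtain u where u: "minor A I J = u * minor B I J" and choice: "minor_choice B s I J"
      using multiple[OF IJ] by blast
    have "minor B I J \<in> Idl\<^bsub>?R\<^esub> ?G"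
      using R.genideal_self[of ?G] choice by (auto simp: carrier)
    then show ?thesis
      using B.I_l_closed[of "minor B I J" u] by (simp add: u carrier mult)
  qed
  then show ?thesis
    unfolding minors_ideal_def by (intro R.genideal_minimal B.is_ideal) auto
qed


section \<open>Comparison of the two matrices\<close>

text \<open>
  In the derivative columns the row factor \<open>e\<^sub>M\<close> comes from differentiating \<open>M\<close>; in the point
  columns it cancels the denominator of \<open>c\<^sub>M = d!/e\<^sub>M\<close>, and the column factor cancels the \<open>d!\<close>
  that remains.
\<close>

lemma transpose_interpolation_matrix_entry:
  fixes m M :: "nat \<Rightarrow> 'n::finite monomial"
  assumes d: "d \<ge> 1"
    and m: "m ` {..<(n + d - 1) choose n} \<subseteq> monomials_of_degree (d - 1)"
    and M: "M ` {..<(n + d) choose n} \<subseteq> monomials_of_degree d"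
    and i: "i < (n + d) choose n" and j: "j < r + ((n + d - 1) choose n)"
  shows "transpose_mat (interpolation_matrix n d r v m M) $$ (i, j)
       = const_poly (of_nat (monomial_e (M i))) * const_poly (if j < r then 1 / fact d else 1)
           * macaulay_duality_matrix n d r v m M $$ (i, j)"
proof -
  have degree_M: "monomial_degree (M i) = d"
    using M i by (auto simp: monomials_of_degree_def)
  show ?thesis
  proof (cases "j < r")
    case True
    then show ?thesis
      using i j monomial_e_pos[of "M i"]
      by (simp add: interpolation_matrix_def macaulay_duality_matrix_def monomial_c_def degree_M
          const_poly_mult[symmetric])
  next
    case False
    then have "m (j - r) \<in> monomials_of_degree (d - 1)"
      using m j by auto
    then have "monomial_degree (M i) = Suc (monomial_degree (m (j - r)))"
      using d degree_M by (simp add: monomials_of_degree_def)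
    then show ?thesis
      using i j False
      by (simp add: interpolation_matrix_def macaulay_duality_matrix_def const_poly_1
          monomial_deriv_degree_Suc)
  qed
qed

theorem proposition2p3:
  fixes n d r :: nat
    and Z :: "('n::finite \<Rightarrow> complex) set set"
    and P :: "nat \<Rightarrow> ('n \<Rightarrow> complex) set"
    and v :: "nat \<Rightarrow> 'n \<Rightarrow> complex"
    and m M :: "nat \<Rightarrow> 'n monomial"
    and \<Lambda> N T :: "'n poly_ring mat"
  assumes variables: "CARD('n) = n + 1"
    and d: "d \<ge> 1"
    and Z: "Z \<subseteq> projective_space"
    and points: "bij_betw P {..<r} Z"
    and representatives: "\<And>i. i < r \<Longrightarrow> v i \<in> P i"
    and m: "bij_betw m {..<(n + d - 1) choose n} (monomials_of_degree (d - 1))"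
    and M: "bij_betw M {..<(n + d) choose n} (monomials_of_degree d)"
    and \<Lambda>: "\<Lambda> = interpolation_matrix n d r v m M"
    and N: "N = transpose_mat \<Lambda>"
    and T: "T = macaulay_duality_matrix n d r v m M"
  shows "(\<forall>s I J j. minor_choice T s I J \<and> j = card (J \<inter> {..<r}) \<longrightarrow>
            minor N I J =
              const_poly ((\<Prod>i\<in>I. of_nat (monomial_e (M i))) / fact d ^ j) * minor T I J)
       \<and> (\<forall>s. minors_ideal s T = minors_ideal s \<Lambda>)"
proof -
  define factor where
    "factor I J = (\<Prod>i\<in>I. of_nat (monomial_e (M i))) / (fact d :: complex) ^ card (J \<inter> {..<r})"
    for I J
  have dims: "dim_row N = dim_row T" "dim_col N = dim_col T"
    by (simp_all add: N \<Lambda> T interpolation_matrix_def macaulay_duality_matrix_def)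
  then have choice: "minor_choice N s I J \<longleftrightarrow> minor_choice T s I J" for s I J
    by (simp add: minor_choice_def)
  have minors: "minor N I J = const_poly (factor I J) * minor T I J"
    if IJ: "minor_choice T s I J" for s I J
  proof -
    have I: "I \<subseteq> {..<(n + d) choose n}" and J: "J \<subseteq> {..<r + ((n + d - 1) choose n)}"
      using IJ by (auto simp: minor_choice_def T macaulay_duality_matrix_def)
    have "minor N I J = (\<Prod>i\<in>I. const_poly (of_nat (monomial_e (M i))))
        * (\<Prod>j\<in>J. const_poly (if j < r then 1 / fact d else 1)) * minor T I J"
    proof (rule minor_rescale[OF IJ dims])
      fix i j assume "i \<in> I" "j \<in> J"
      then show "N $$ (i, j) = const_poly (of_nat (monomial_e (M i)))
          * const_poly (if j < r then 1 / fact d else 1) * T $$ (i, j)"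
        using I J unfolding N \<Lambda> T
        by (intro transpose_interpolation_matrix_entry d)
           (use bij_betw_imp_surj_on[OF m] bij_betw_imp_surj_on[OF M] in auto)
    qed
    moreover have "(\<Prod>j\<in>J. if j < r then 1 / fact d else 1 :: complex)
        = 1 / fact d ^ card (J \<inter> {..<r})"
      using finite_subset[OF J]
      by (simp add: prod.If_cases power_one_over lessThan_def)
    ultimately show ?thesis
      by (simp add: factor_def const_poly_prod[symmetric] const_poly_mult[symmetric])
  qed
  have "monomial_e (M i) \<noteq> 0" for i
    using monomial_e_pos[of "M i"] by simp
  then have "factor I J \<noteq> 0" if "finite I" for I J
    using that by (simp add: factor_def)
  then have unit: "const_poly (1 / factor I J) * const_poly (factor I J) = 1" if "finite I" for I J
    using that by (simp add: const_poly_mult[symmetric] const_poly_1)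
  have "minors_ideal s T = minors_ideal s N" for s
  proof (rule subset_antisym; rule minors_ideal_mono)
    fix I J assume IJ: "minor_choice T s I J"
    then have "finite I"
      using finite_subset by (auto simp: minor_choice_def)
    then have "minor T I J = const_poly (1 / factor I J) * minor N I J"
      by (simp add: minors[OF IJ] unit mult.assoc[symmetric])
    then show "minor_choice N s I J \<and> (\<exists>u. minor T I J = u * minor N I J)"
      using IJ choice by blast
  next
    fix I J assume "minor_choice N s I J"
    then show "minor_choice T s I J \<and> (\<exists>u. minor N I J = u * minor T I J)"
      using choice minors by blast
  qed
  then have "minors_ideal s T = minors_ideal s \<Lambda>" for s
    by (simp add: N minors_ideal_transpose)
  then show ?thesis
    using minors by (auto simp: factor_def)
qed

end
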